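(* Let $R>0$ and let $\rho\in(-1,1)$, $\rho\neq 0$. Consider the linear transformation $$\begin{pmatrix} w\\ z\end{pmatrix}=\begin{pmatrix}\frac{1}{\sqrt{2(1-|\rho|)}} & -\frac{\operatorname{sgn}(\rho)}{\sqrt{2(1-|\rho|)}}\\ \frac{\operatorname{sgn}(\rho)}{\sqrt{2(1+|\rho|)}} & \frac{1}{\sqrt{2(1+|\rho|)}}\end{pmatrix}\begin{pmatrix}x\\ y\end{pmatrix}.$$ Then, under this change of variables, the following relationship between differential operators holds: $$\frac{\partial^2}{\partial x^2}+2\rho\frac{\partial^2}{\partial x\,\partial y}+\frac{\partial^2}{\partial y^2}=\frac{\partial^2}{\partial w^2}+\frac{\partial^2}{\partial z^2}.$$ Moreover, the circle $\{(x,y)\in\mathbb{R}^2: x^2+y^2=R^2\}$ is mapped into the ellipse $$\frac{w^2}{a^2}+\frac{z^2}{b^2}=1,\qquad a=\frac{R}{\sqrt{1-|\rho|}},\qquad b=\frac{R}{\sqrt{1+|\rho|}}.$$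
   Context: $\operatorname{sgn}(\rho)$ is $1$ if $\rho>0$ and $-1$ if $\rho<0$. The equality of operators means that, for a twice continuously differentiable function regarded as a function of $(x,y)$ on one side and, through the linear change of variables, as a function of $(w,z)$ on the other side, the two expressions agree at corresponding points. *)

theory Defs
  imports "HOL-Analysis.Analysis"
begin

(* Twice continuous differentiability in the Frechet sense; f' is the first derivative,
   f'' the second, and continuity of f' follows from its differentiability. *)
definition C2_on :: "'a::real_normed_vector set \<Rightarrow> ('a \<Rightarrow> 'b::real_normed_vector) \<Rightarrow> bool" where
  "C2_on U f \<longleftrightarrow>
     (\<exists>(f' :: 'a \<Rightarrow> 'a \<Rightarrow>\<^sub>L 'b) (f'' :: 'a \<Rightarrow> 'a \<Rightarrow>\<^sub>L 'a \<Rightarrow>\<^sub>L 'b).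
        (\<forall>p\<in>U. (f has_derivative blinfun_apply (f' p)) (at p)) \<and>
        (\<forall>p\<in>U. (f' has_derivative blinfun_apply (f'' p)) (at p)) \<and>
        continuous_on U f'')"

definition partial :: "'n::finite \<Rightarrow> (real^'n \<Rightarrow> real) \<Rightarrow> real^'n \<Rightarrow> real" where
  "partial i f p = deriv (\<lambda>t. f (p + t *\<^sub>R axis i 1)) 0"

definition cov_matrix :: "real \<Rightarrow> real^2^2" where
  "cov_matrix \<rho> = vector
     [vector [1 / sqrt (2 * (1 - \<bar>\<rho>\<bar>)), - (sgn \<rho> / sqrt (2 * (1 - \<bar>\<rho>\<bar>)))],
      vector [sgn \<rho> / sqrt (2 * (1 + \<bar>\<rho>\<bar>)), 1 / sqrt (2 * (1 + \<bar>\<rho>\<bar>))]]"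

lemma invertible_cov_matrix:
  assumes "-1 < \<rho>" "\<rho> < 1"
  shows "invertible (cov_matrix \<rho>)"
proof -
  have pos: "0 < sqrt (2 * (1 - \<bar>\<rho>\<bar>))" "0 < sqrt (2 * (1 + \<bar>\<rho>\<bar>))"
    using assms by auto
  have "det (cov_matrix \<rho>)
      = (1 + sgn \<rho> * sgn \<rho>) / (sqrt (2 * (1 - \<bar>\<rho>\<bar>)) * sqrt (2 * (1 + \<bar>\<rho>\<bar>)))"
    by (simp add: det_2 cov_matrix_def add_divide_distrib)
  moreover have "1 + sgn \<rho> * sgn \<rho> > 0"
    by (simp add: sgn_if)
  ultimately have "det (cov_matrix \<rho>) > 0"
    using pos by (metis divide_pos_pos mult_pos_pos)
  then show ?thesis
    by (simp add: invertible_det_nz)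
qed

end

theory Submission
  imports Defs
begin

text \<open>
  For linear \<open>A\<close> with \<open>g (A p) = f p\<close>, moving from \<open>A p\<close> in the direction \<open>A c\<close> changes \<open>g\<close> exactly
  as moving from \<open>p\<close> in the direction \<open>c\<close> changes \<open>f\<close>. So every second partial derivative of \<open>g\<close> at
  \<open>A p\<close> is a value \<open>H c d\<close> of the second derivative \<open>H\<close> of \<open>f\<close> at \<open>p\<close>, where \<open>c, d\<close> are columns of
  the inverse of \<open>A\<close> (lemma \<open>partial_partial_linear_image\<close>). Taking the identity as \<open>A\<close> gives the
  partial derivatives of \<open>f\<close> itself.

  For the matrix at hand the columns of the inverse are \<open>(\<alpha>, - s \<alpha>) / 2\<close> and \<open>(s \<beta>, \<beta>) / 2\<close> with
  \<open>\<alpha>\<^sup>2 = 2 (1 - \<bar>\<rho>\<bar>)\<close>, \<open>\<beta>\<^sup>2 = 2 (1 + \<bar>\<rho>\<bar>)\<close> and \<open>s = sgn \<rho>\<close>. Expanding the bilinear form \<open>H\<close>, the sum of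
  the two pure second derivatives of \<open>g\<close> has the coefficient \<open>(\<alpha>\<^sup>2 + \<beta>\<^sup>2) / 4 = 1\<close> at the pure terms
  and \<open>s (\<beta>\<^sup>2 - \<alpha>\<^sup>2) / 4 = \<rho>\<close> at each of the two mixed terms. These combine to \<open>2 \<rho>\<close> times one mixed
  derivative because \<open>H\<close> is symmetric (lemma \<open>second_derivative_symmetric\<close>).

  The statement about the circle rests on the identity \<open>\<alpha>\<^sup>2 w\<^sup>2 + \<beta>\<^sup>2 z\<^sup>2 = 2 (x\<^sup>2 + y\<^sup>2)\<close>, together with
  the surjectivity of the transformation.
\<close>

section \<open>Symmetry of the second derivative\<close>

text \<open>
  The mean value theorem along \<open>u\<close> turns the second difference into \<open>h\<close> times an increment of \<open>f'\<close>
  in the direction \<open>h v\<close>, and differentiability of \<open>f'\<close> at \<open>p\<close> evaluates that increment. The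
  second difference is invariant under exchanging \<open>u\<close> and \<open>v\<close>; its limit thus yields the symmetry.
\<close>

lemma second_difference_quotient_tendsto:
  fixes f :: "'a::real_normed_vector \<Rightarrow> real"
    and f' :: "'a \<Rightarrow> 'a \<Rightarrow>\<^sub>L real" and H :: "'a \<Rightarrow>\<^sub>L 'a \<Rightarrow>\<^sub>L real"
  assumes "open U" "p \<in> U"
    and f': "\<And>q. q \<in> U \<Longrightarrow> (f has_derivative blinfun_apply (f' q)) (at q)"
    and H: "(f' has_derivative blinfun_apply H) (at p)"
  shows "((\<lambda>h. (f (p + h *\<^sub>R u + h *\<^sub>R v) - f (p + h *\<^sub>R u) - f (p + h *\<^sub>R v) + f p) / h\<^sup>2)
           \<longlongrightarrow> H v u) (at_right 0)"
proof (rule tendstoI)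
  fix e :: real assume "e > 0"
  let ?S = "\<lambda>h. f (p + h *\<^sub>R u + h *\<^sub>R v) - f (p + h *\<^sub>R u) - f (p + h *\<^sub>R v) + f p"
  \<comment> \<open>All points of the parallelogram spanned by \<open>h u\<close> and \<open>h v\<close> lie within \<open>h N\<close> of \<open>p\<close>; the summand 1
    keeps \<open>N\<close> positive when \<open>u = v = 0\<close>. The error below is at most \<open>2 e' N\<^sup>2\<close>, and the 3 makes this
    strictly less than \<open>e\<close>.\<close>
  define N where "N = norm u + norm v + 1"
  have N: "N > 0" unfolding N_def by (smt (verit) norm_ge_zero)
  define e' where "e' = e / (3 * N\<^sup>2)"
  have e': "e' > 0" using \<open>e > 0\<close> N by (simp add: e'_def)
  obtain d1 where d1: "d1 > 0" "ball p d1 \<subseteq> U"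
    using assms(1,2) openE by blast
  obtain d2 where d2: "d2 > 0"
    "\<And>q. norm (q - p) < d2 \<Longrightarrow> norm (f' q - f' p - H (q - p)) \<le> e' * norm (q - p)"
    using H e' unfolding has_derivative_at_alt by blast
  define d where "d = min d1 d2 / N"
  have d: "d > 0" using d1(1) d2(1) N by (simp add: d_def)
  have main: "dist (?S h / h\<^sup>2) (H v u) < e" if h: "0 < h" "h < d" for h
  proof -
    have hN: "h * N < min d1 d2"
      using h N by (simp add: d_def pos_less_divide_eq)
    have small: "norm (s *\<^sub>R u + r *\<^sub>R v) \<le> h * N" if "0 \<le> s" "s \<le> h" "0 \<le> r" "r \<le> h" for s r
    proof -
      have "norm (s *\<^sub>R u + r *\<^sub>R v) \<le> s * norm u + r * norm v"
        using norm_triangle_ineq[of "s *\<^sub>R u" "r *\<^sub>R v"] that by simp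
      also have "\<dots> \<le> h * norm u + h * norm v"
        by (intro add_mono mult_right_mono that) auto
      also have "\<dots> \<le> h * N" using h by (simp add: N_def algebra_simps)
      finally show ?thesis .
    qed
    have inU: "p + s *\<^sub>R u + r *\<^sub>R v \<in> U" if "0 \<le> s" "s \<le> h" "0 \<le> r" "r \<le> h" for s r
    proof -
      have "norm (s *\<^sub>R u + r *\<^sub>R v) < d1" using small[OF that] hN by linarith
      then have "p + (s *\<^sub>R u + r *\<^sub>R v) \<in> ball p d1" 
        using norm_minus_cancel[of "s *\<^sub>R u + r *\<^sub>R v"] by (simp add: dist_norm)
      then show ?thesis using d1(2) by (auto simp: add.assoc)
    qed
    have der: "((\<lambda>s. f (p + s *\<^sub>R u + r *\<^sub>R v)) has_real_derivative
                 f' (p + s *\<^sub>R u + r *\<^sub>R v) u) (at s)"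
      if "0 \<le> s" "s \<le> h" "0 \<le> r" "r \<le> h" for s r
    proof -
      have "((\<lambda>s. p + s *\<^sub>R u + r *\<^sub>R v) has_derivative (\<lambda>t. t *\<^sub>R u)) (at s)"
        by (auto intro!: derivative_eq_intros)
      from has_derivative_compose[OF this f'[OF inU[OF that]]]
      show ?thesis
        by (simp add: has_field_derivative_def blinfun.scaleR_right mult_commute_abs)
    qed
    \<comment> \<open>Mean value theorem in \<open>s\<close> for the difference of \<open>f\<close> on two parallel segments in direction \<open>u\<close>.
      The term with factor 0 makes both segments instances of \<open>der\<close>, with \<open>r = h\<close> and \<open>r = 0\<close>.\<close>
    have "\<exists>s. 0 < s \<and> s < h \<and>
        (f (p + h *\<^sub>R u + h *\<^sub>R v) - f (p + h *\<^sub>R u + 0 *\<^sub>R v))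
        - (f (p + 0 *\<^sub>R u + h *\<^sub>R v) - f (p + 0 *\<^sub>R u + 0 *\<^sub>R v))
        = (h - 0) * (f' (p + s *\<^sub>R u + h *\<^sub>R v) u - f' (p + s *\<^sub>R u + 0 *\<^sub>R v) u)"
      by (rule MVT2[OF h(1)], rule DERIV_diff; rule der) (use h in simp_all)
    then obtain s where s: "0 < s" "s < h" and
      S: "?S h = h * (f' (p + s *\<^sub>R u + h *\<^sub>R v) u - f' (p + s *\<^sub>R u + 0 *\<^sub>R v) u)"
      by auto
    \<comment> \<open>The increment of \<open>f'\<close> between the two segments is compared through \<open>p\<close>, the only point at
      which \<open>f'\<close> is known to be differentiable; the \<open>s u\<close> parts cancel.\<close>
    define E where "E r = f' (p + s *\<^sub>R u + r *\<^sub>R v) - f' p - H (s *\<^sub>R u + r *\<^sub>R v)" for r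
    have E: "norm (E r) \<le> e' * (h * N)" if "0 \<le> r" "r \<le> h" for r
    proof -
      have sm: "norm (s *\<^sub>R u + r *\<^sub>R v) \<le> h * N" using small s that by simp
      have "norm (E r) \<le> e' * norm (s *\<^sub>R u + r *\<^sub>R v)"
        using d2(2)[of "p + s *\<^sub>R u + r *\<^sub>R v"] sm hN by (simp add: E_def add.assoc)
      also have "\<dots> \<le> e' * (h * N)" using sm e' by simp
      finally show ?thesis .
    qed
    have "?S h = h\<^sup>2 * H v u + h * (E h - E 0) u"
      unfolding S E_def
      by (simp add: blinfun.bilinear_simps algebra_simps power2_eq_square)
    then have "?S h / h\<^sup>2 - H v u = (E h - E 0) u / h"
      using h by (simp add: field_simps power2_eq_square)
    also have "\<bar>\<dots>\<bar> \<le> 2 * e' * N\<^sup>2"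
    proof -
      have "\<bar>(E h - E 0) u\<bar> \<le> norm (E h - E 0) * norm u"
        using norm_blinfun[of "E h - E 0" u] by simp
      also have "\<dots> \<le> (2 * (e' * (h * N))) * N"
        using E[of h] E[of 0] h norm_triangle_ineq4[of "E h" "E 0"] e' N
        by (intro mult_mono) (auto simp: N_def)
      finally show ?thesis using h by (simp add: field_simps power2_eq_square)
    qed
    also have "\<dots> < e" using N \<open>e > 0\<close> by (simp add: e'_def)
    finally show ?thesis by (simp add: dist_real_def)
  qed
  show "\<forall>\<^sub>F h in at_right 0. dist (?S h / h\<^sup>2) (H v u) < e"
    unfolding eventually_at_right_field using d main by auto
qed

lemma second_derivative_symmetric:
  fixes f :: "'a::real_normed_vector \<Rightarrow> real"
    and f' :: "'a \<Rightarrow> 'a \<Rightarrow>\<^sub>L real" and H :: "'a \<Rightarrow>\<^sub>L 'a \<Rightarrow>\<^sub>L real"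
  assumes "open U" "p \<in> U"
    and "\<And>q. q \<in> U \<Longrightarrow> (f has_derivative blinfun_apply (f' q)) (at q)"
    and "(f' has_derivative blinfun_apply H) (at p)"
  shows "H u v = H v u"
proof (rule tendsto_unique)
  let ?Q = "\<lambda>h. (f (p + h *\<^sub>R u + h *\<^sub>R v) - f (p + h *\<^sub>R u) - f (p + h *\<^sub>R v) + f p) / h\<^sup>2"
  show "(?Q \<longlongrightarrow> H v u) (at_right 0)"
    using second_difference_quotient_tendsto[OF assms] .
  show "(?Q \<longlongrightarrow> H u v) (at_right 0)"
    using second_difference_quotient_tendsto[OF assms, of v u] by (simp add: algebra_simps)
qed simp

section \<open>Partial derivatives under a linear change of variables\<close>

text \<open>
  Only the values of \<open>g\<close> on the image of \<open>U\<close> are constrained; that suffices because the line through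
  \<open>A p\<close> along the axis is, near \<open>A p\<close>, the image of a line through \<open>p\<close> inside \<open>U\<close>. The function \<open>f\<close>
  may itself be a partial derivative, which is how second derivatives are obtained.
\<close>

lemma partial_linear_image:
  fixes f :: "'a::real_normed_vector \<Rightarrow> real" and g :: "real^'n \<Rightarrow> real"
  assumes "open U" "p \<in> U" "linear A"
    and c: "A c = axis i 1"
    and g: "\<And>q. q \<in> U \<Longrightarrow> g (A q) = f q"
    and D: "(f has_derivative D) (at p)"
  shows "partial i g (A p) = D c"
proof -
  have line: "((\<lambda>t. p + t *\<^sub>R c) has_derivative (\<lambda>t. t *\<^sub>R c)) (at 0)"
    by (auto intro!: derivative_eq_intros)
  have "isCont (\<lambda>t. p + t *\<^sub>R c) 0"
    using line by (rule has_derivative_continuous)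
  then have "\<forall>\<^sub>F t in nhds 0. p + t *\<^sub>R c \<in> U"
    using assms(1,2) by (auto simp: continuous_at_open eventually_nhds)
  then have "\<forall>\<^sub>F t in nhds 0. g (A p + t *\<^sub>R axis i 1) = f (p + t *\<^sub>R c)"
    by (rule eventually_mono)
      (metis g c linear_add[OF \<open>linear A\<close>] linear_cmul[OF \<open>linear A\<close>])
  then have "partial i g (A p) = deriv (\<lambda>t. f (p + t *\<^sub>R c)) 0"
    unfolding partial_def by (rule deriv_cong_ev) simp
  also have "((\<lambda>t. f (p + t *\<^sub>R c)) has_derivative (\<lambda>t. D (t *\<^sub>R c))) (at 0)"
    using has_derivative_compose[OF line, of f D] D by simp
  then have "deriv (\<lambda>t. f (p + t *\<^sub>R c)) 0 = D c"
    using linear_cmul[OF has_derivative_linear[OF D]]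
    by (intro DERIV_imp_deriv) (simp add: has_field_derivative_def mult_commute_abs)
  finally show ?thesis .
qed

lemma partial_partial_linear_image:
  fixes f :: "'a::real_normed_vector \<Rightarrow> real" and g :: "real^'n \<Rightarrow> real"
    and f' :: "'a \<Rightarrow> 'a \<Rightarrow>\<^sub>L real" and H :: "'a \<Rightarrow>\<^sub>L 'a \<Rightarrow>\<^sub>L real"
  assumes "open U" "p \<in> U" "linear A"
    and c: "A c = axis i 1" and d: "A d = axis j 1"
    and g: "\<And>q. q \<in> U \<Longrightarrow> g (A q) = f q"
    and f': "\<And>q. q \<in> U \<Longrightarrow> (f has_derivative blinfun_apply (f' q)) (at q)"
    and H: "(f' has_derivative blinfun_apply H) (at p)"
  shows "partial i (partial j g) (A p) = H c d"
proof (rule partial_linear_image[OF assms(1-3) c])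
  show "partial j g (A q) = f' q d" if "q \<in> U" for q
    using that by (intro partial_linear_image[OF \<open>open U\<close> _ \<open>linear A\<close> d g f'])
  show "((\<lambda>q. f' q d) has_derivative (\<lambda>x. H x d)) (at p)"
    using H by (auto intro!: derivative_eq_intros)
qed

section \<open>The covariance transformation\<close>

lemma cov_matrix_mult:
  "(cov_matrix \<rho> *v p) $ 1 = (p $ 1 - sgn \<rho> * p $ 2) / sqrt (2 * (1 - \<bar>\<rho>\<bar>))"
  "(cov_matrix \<rho> *v p) $ 2 = (sgn \<rho> * p $ 1 + p $ 2) / sqrt (2 * (1 + \<bar>\<rho>\<bar>))"
  by (simp_all add: cov_matrix_def matrix_vector_mult_def sum_2 diff_divide_distrib add_divide_distrib)

text \<open>
  For \<open>0 < \<bar>\<rho>\<bar> < 1\<close> these are the columns of the inverse of \<open>cov_matrix \<rho>\<close>, that is, the preimages of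
  the two axis vectors. They give the directions in the \<open>(x, y)\<close>-plane along which \<open>\<partial>/\<partial>w\<close> and
  \<open>\<partial>/\<partial>z\<close> differentiate.
\<close>

definition cov_col1 :: "real \<Rightarrow> real^2" where
  "cov_col1 \<rho> = (sqrt (2 * (1 - \<bar>\<rho>\<bar>)) / 2) *\<^sub>R (axis 1 1 - sgn \<rho> *\<^sub>R axis 2 1)"

definition cov_col2 :: "real \<Rightarrow> real^2" where
  "cov_col2 \<rho> = (sqrt (2 * (1 + \<bar>\<rho>\<bar>)) / 2) *\<^sub>R (sgn \<rho> *\<^sub>R axis 1 1 + axis 2 1)"

lemma
  assumes "\<bar>\<rho>\<bar> < 1" "\<rho> \<noteq> 0"
  shows cov_matrix_col1: "cov_matrix \<rho> *v cov_col1 \<rho> = axis 1 1"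
    and cov_matrix_col2: "cov_matrix \<rho> *v cov_col2 \<rho> = axis 2 1"
proof -
  have "sqrt (2 * (1 - \<bar>\<rho>\<bar>)) > 0" "sqrt (2 * (1 + \<bar>\<rho>\<bar>)) > 0" "sgn \<rho> * sgn \<rho> = 1"
    using assms by (auto simp: sgn_if)
  then show "cov_matrix \<rho> *v cov_col1 \<rho> = axis 1 1" "cov_matrix \<rho> *v cov_col2 \<rho> = axis 2 1"
    by (simp_all add: vec_eq_iff forall_2 cov_matrix_mult cov_col1_def cov_col2_def axis_def
        field_simps)
qed

text \<open>
  This is the operator identity for a single symmetric form \<open>H\<close>. The squared lengths
  \<open>1 - \<bar>\<rho>\<bar>\<close> and \<open>1 + \<bar>\<rho>\<bar>\<close> of the two columns add up to 2 and differ by \<open>2 \<bar>\<rho>\<bar>\<close>; the pure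
  terms of \<open>H\<close> see the sum, while the mixed terms, whose signs in the two columns are opposite, see
  the difference.
\<close>

lemma bilinear_form_cov_cols:
  fixes H :: "(real^2) \<Rightarrow>\<^sub>L (real^2) \<Rightarrow>\<^sub>L real"
  assumes "\<bar>\<rho>\<bar> < 1" "\<rho> \<noteq> 0" and sym: "\<And>u v. H u v = H v u"
  shows "H (cov_col1 \<rho>) (cov_col1 \<rho>) + H (cov_col2 \<rho>) (cov_col2 \<rho>)
    = H (axis 1 1) (axis 1 1) + 2 * \<rho> * H (axis 1 1) (axis 2 1) + H (axis 2 1) (axis 2 1)"
proof -
  let ?s = "sgn \<rho>"
  define H11 H12 H22 where H: "H11 = H (axis 1 1) (axis 1 1)"
    "H12 = H (axis 1 1) (axis 2 1)" "H22 = H (axis 2 1) (axis 2 1)"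
  have sq: "?s * ?s = 1" using assms by (auto simp: sgn_if)
  \<comment> \<open>Folding the square root keeps it from being rewritten during the bilinear expansion.\<close>
  define k where "k = sqrt (2 * (1 - \<bar>\<rho>\<bar>)) / 2"
  have "H (cov_col1 \<rho>) (cov_col1 \<rho>)
      = (sqrt (2 * (1 - \<bar>\<rho>\<bar>)) / 2)\<^sup>2 * (H11 - 2 * ?s * H12 + ?s * ?s * H22)"
    unfolding cov_col1_def k_def[symmetric]
    by (simp add: blinfun.bilinear_simps sym[of "axis 2 1" "axis 1 1"] H
        power2_eq_square algebra_simps)
  also have "\<dots> = (1 - \<bar>\<rho>\<bar>) / 2 * (H11 - 2 * ?s * H12 + H22)"
    using assms(1) sq by (simp add: power_divide)
  finally have 1: "H (cov_col1 \<rho>) (cov_col1 \<rho>) = \<dots>" .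
  define l where "l = sqrt (2 * (1 + \<bar>\<rho>\<bar>)) / 2"
  have "H (cov_col2 \<rho>) (cov_col2 \<rho>)
      = (sqrt (2 * (1 + \<bar>\<rho>\<bar>)) / 2)\<^sup>2 * (?s * ?s * H11 + 2 * ?s * H12 + H22)"
    unfolding cov_col2_def l_def[symmetric]
    by (simp add: blinfun.bilinear_simps sym[of "axis 2 1" "axis 1 1"] H
        power2_eq_square algebra_simps)
  also have "\<dots> = (1 + \<bar>\<rho>\<bar>) / 2 * (H11 + 2 * ?s * H12 + H22)"
    using assms(1) sq by (simp add: power_divide)
  finally have 2: "H (cov_col2 \<rho>) (cov_col2 \<rho>) = \<dots>" .
  have "H (cov_col1 \<rho>) (cov_col1 \<rho>) + H (cov_col2 \<rho>) (cov_col2 \<rho>)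
      = H11 + 2 * (?s * \<bar>\<rho>\<bar>) * H12 + H22"
    unfolding 1 2 by (simp add: field_simps)
  also have "?s * \<bar>\<rho>\<bar> = \<rho>" by (simp add: sgn_mult_abs)
  finally show ?thesis by (simp add: H)
qed

text \<open>
  The mixed terms of \<open>(x - s y)\<^sup>2 + (s x + y)\<^sup>2\<close> cancel. The weights are \<open>R\<^sup>2 / a\<^sup>2\<close> and \<open>R\<^sup>2 / b\<^sup>2\<close>, so the
  left-hand side is \<open>R\<^sup>2\<close> exactly on the ellipse.
\<close>

lemma cov_matrix_quadratic_form:
  assumes "\<bar>\<rho>\<bar> < 1" "\<rho> \<noteq> 0"
  shows "(1 - \<bar>\<rho>\<bar>) * ((cov_matrix \<rho> *v p) $ 1)\<^sup>2 + (1 + \<bar>\<rho>\<bar>) * ((cov_matrix \<rho> *v p) $ 2)\<^sup>2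
    = (p $ 1)\<^sup>2 + (p $ 2)\<^sup>2"
proof -
  have sq: "(sgn \<rho>)\<^sup>2 = 1" using assms by (auto simp: sgn_if)
  have "(1 - \<bar>\<rho>\<bar>) * ((cov_matrix \<rho> *v p) $ 1)\<^sup>2 = (p $ 1 - sgn \<rho> * p $ 2)\<^sup>2 / 2"
    "(1 + \<bar>\<rho>\<bar>) * ((cov_matrix \<rho> *v p) $ 2)\<^sup>2 = (sgn \<rho> * p $ 1 + p $ 2)\<^sup>2 / 2"
    using assms by (simp_all add: cov_matrix_mult power_divide field_simps)
  then show ?thesis
    using sq by (simp add: power2_sum power2_diff power_mult_distrib add_divide_distrib diff_divide_distrib)
qed

theorem theorem1:
  fixes R \<rho> a b :: real
  assumes "R > 0" and "\<rho> \<in> {-1<..<1}" and "\<rho> \<noteq> 0"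
    and "a = R / sqrt (1 - \<bar>\<rho>\<bar>)" and "b = R / sqrt (1 + \<bar>\<rho>\<bar>)"
  shows "(\<forall>(U :: (real^2) set) (f :: real^2 \<Rightarrow> real) (g :: real^2 \<Rightarrow> real).
            open U \<and> C2_on U f \<and> (\<forall>p\<in>U. g (cov_matrix \<rho> *v p) = f p) \<longrightarrow>
            (\<forall>p\<in>U. partial 1 (partial 1 f) p + 2 * \<rho> * partial 1 (partial 2 f) p
                     + partial 2 (partial 2 f) p
                   = partial 1 (partial 1 g) (cov_matrix \<rho> *v p)
                     + partial 2 (partial 2 g) (cov_matrix \<rho> *v p)))
       \<and> (\<lambda>p. cov_matrix \<rho> *v p) ` {p. (p $ 1)\<^sup>2 + (p $ 2)\<^sup>2 = R\<^sup>2}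
           = {q. (q $ 1)\<^sup>2 / a\<^sup>2 + (q $ 2)\<^sup>2 / b\<^sup>2 = 1}"
proof (intro conjI allI impI ballI)
  have \<rho>: "\<bar>\<rho>\<bar> < 1" using assms(2) by auto
  let ?A = "\<lambda>p. cov_matrix \<rho> *v p"
  {
    fix U :: "(real^2) set" and f g :: "real^2 \<Rightarrow> real" and p :: "real^2"
    assume *: "open U \<and> C2_on U f \<and> (\<forall>p\<in>U. g (?A p) = f p)" and p: "p \<in> U"
    then have U: "open U" and g: "\<And>q. q \<in> U \<Longrightarrow> g (?A q) = f q" by auto
    obtain f' f'' where f': "\<And>q. q \<in> U \<Longrightarrow> (f has_derivative blinfun_apply (f' q)) (at q)"
      and f'': "\<And>q. q \<in> U \<Longrightarrow> (f' has_derivative blinfun_apply (f'' q)) (at q)"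
      using * unfolding C2_on_def by blast
    have Dg: "partial i (partial j g) (?A p) = f'' p c d"
      if "?A c = axis i 1" "?A d = axis j 1" for i j c d
      by (rule partial_partial_linear_image[OF U p matrix_vector_mul_linear that g f' f''[OF p]])
    have Df: "partial i (partial j f) p = f'' p (axis i 1) (axis j 1)" for i j
      by (rule partial_partial_linear_image[OF U p linear_id[unfolded id_def] refl refl refl
            f' f''[OF p]])
    have "f'' p u v = f'' p v u" for u v
      by (rule second_derivative_symmetric[OF U p f' f''[OF p]])
    from bilinear_form_cov_cols[OF \<rho> assms(3) this]
    show "partial 1 (partial 1 f) p + 2 * \<rho> * partial 1 (partial 2 f) p + partial 2 (partial 2 f) p
        = partial 1 (partial 1 g) (?A p) + partial 2 (partial 2 g) (?A p)"
      using Dg[OF cov_matrix_col1 cov_matrix_col1] Dg[OF cov_matrix_col2 cov_matrix_col2]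
        \<rho> assms(3) by (simp add: Df)
  }
  have "(?A p $ 1)\<^sup>2 / a\<^sup>2 + (?A p $ 2)\<^sup>2 / b\<^sup>2 = ((p $ 1)\<^sup>2 + (p $ 2)\<^sup>2) / R\<^sup>2" for p
    unfolding cov_matrix_quadratic_form[OF \<rho> assms(3), symmetric]
    using \<rho> by (simp add: assms(4,5) power_divide add_divide_distrib mult.commute)
  then have "(p $ 1)\<^sup>2 + (p $ 2)\<^sup>2 = R\<^sup>2 \<longleftrightarrow> (?A p $ 1)\<^sup>2 / a\<^sup>2 + (?A p $ 2)\<^sup>2 / b\<^sup>2 = 1" for p
    using assms(1) by auto
  moreover have "surj ?A"
    using invertible_cov_matrix[of \<rho>] assms(2)
    by (metis greaterThanLessThan_iff invertible_right_inverse matrix_right_invertible_surjective)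
  ultimately show "?A ` {p. (p $ 1)\<^sup>2 + (p $ 2)\<^sup>2 = R\<^sup>2} = {q. (q $ 1)\<^sup>2 / a\<^sup>2 + (q $ 2)\<^sup>2 / b\<^sup>2 = 1}"
    by (auto simp: image_iff)
qed

end
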